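(* Let $X$ be a topological space and let $(X,\Sigma,\mu)$ be a measure space such that every open subset of $X$ belongs to $\Sigma$. Suppose that $\mu$ is finite, nonatomic, and weakly outer regular. Let $f,g\in L^1(X,\Sigma,\mu)$ be real-valued. Then there exists a common O-segment for $\mu_f$ and $\mu_g$; that is, there exists a family of open sets $u(t)\subseteq X$, $t\in[0,1]$, such that $u(0)=\emptyset$, $u(1)=X$, $u(s)\subseteq u(t)$ whenever $s<t$, and $$\int_{u(t)} f\,d\mu = t\int_X f\,d\mu,\qquad \int_{u(t)} g\,d\mu=t\int_X g\,d\mu\qquad\text{for all } t\in[0,1].$$
   Context: Measures are nonnegative. A measure space $(X,\Sigma,\mu)$ is nonatomic if for every $A\in\Sigma$ with $\mu(A)>0$ there exists $B\in\Sigma$, $B\subseteq A$, with $0<\mu(B)<\mu(A)$. A finite measure $\mu$ on a topological space $X$ for which all open sets are measurable is weakly outer regular if for every $A\in\Sigma$ and every $\epsilon>0$ there exists an open set $O$ such that $\mu(A\setminus O)=0$ and $\mu(O\setminus A)<\epsilon$. For $f\in L^1(X,\Sigma,\mu)$, $\mu_f:\Sigma\to\mathbb{R}$ is the $\sigma$-additive function $\mu_f(E)=\int_E f\,d\mu$. For a finite measure space, a segment for a $\sigma$-additive function $\eta$ on $\Sigma$ is a family $u(t)\in\Sigma$, $t\in[0,1]$, with $u(0)=\emptyset$, $u(1)=X$, $u(s)\subseteq u(t)$ if $s<t$, and $\eta(u(t))=t\,\eta(X)$ for all $t\in[0,1]$. An O-segment is a segment such that $u(t)$ is open for all $t$. 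*)

theory Defs
  imports "HOL-Analysis.Analysis"
begin

definition nonatomic :: "'a measure \<Rightarrow> bool" where
  "nonatomic M \<longleftrightarrow>
     (\<forall>A\<in>sets M. emeasure M A > 0 \<longrightarrow>
        (\<exists>B\<in>sets M. B \<subseteq> A \<and> 0 < emeasure M B \<and> emeasure M B < emeasure M A))"

text \<open>
  Topological spaces are explicit values of type \<^typ>\<open>'a topology\<close>. The notions below are meant for
  a topology \<open>X\<close> and a finite measure \<open>M\<close> such that \<open>topspace X = space M\<close> and every open set of
  \<open>X\<close> belongs to \<open>sets M\<close>, which may be larger than the Borel sets of \<open>X\<close>.
\<close>

definition weakly_outer_regular :: "'a topology \<Rightarrow> 'a measure \<Rightarrow> bool" where
  "weakly_outer_regular X M \<longleftrightarrow>
     (\<forall>A\<in>sets M. \<forall>\<epsilon>::real. \<epsilon> > 0 \<longrightarrow>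
        (\<exists>U. openin X U \<and> emeasure M (A - U) = 0 \<and> emeasure M (U - A) < ennreal \<epsilon>))"

definition integral_fun :: "'a measure \<Rightarrow> ('a \<Rightarrow> real) \<Rightarrow> 'a set \<Rightarrow> real" where
  "integral_fun M f E = (LINT x:E|M. f x)"

text \<open>
  A family indexed by \<open>[0,1]\<close> is a function on all reals whose values outside \<open>[0,1]\<close> are ignored.
\<close>

definition segment :: "'a measure \<Rightarrow> ('a set \<Rightarrow> real) \<Rightarrow> (real \<Rightarrow> 'a set) \<Rightarrow> bool" where
  "segment M \<eta> u \<longleftrightarrow>
     (\<forall>t\<in>{0..1}. u t \<in> sets M) \<and>
     u 0 = {} \<and> u 1 = space M \<and>
     (\<forall>s\<in>{0..1}. \<forall>t\<in>{0..1}. s < t \<longrightarrow> u s \<subseteq> u t) \<and>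
     (\<forall>t\<in>{0..1}. \<eta> (u t) = t * \<eta> (space M))"

definition O_segment ::
  "'a topology \<Rightarrow> 'a measure \<Rightarrow> ('a set \<Rightarrow> real) \<Rightarrow> (real \<Rightarrow> 'a set) \<Rightarrow> bool" where
  "O_segment X M \<eta> u \<longleftrightarrow> segment M \<eta> u \<and> (\<forall>t\<in>{0..1}. openin X (u t))"

end

(*
  By repeated halving it is enough to find, between two nested open sets A and B, an open set whose
  integrals of 1, f and g are the means of those of A and B. The functions are added one at a
  time, starting from 1, where nonatomicity and regularity suffice. If U and U' are open with equal
  integrals of the functions treated so far, take chains a and b of open sets along which these
  integrals are affine, a from U Int U' to U' and b from U Int U' to U. Then a(t) Un b(1 - t)
  passes from U to U' through open sets with the same integrals, and the integral of the next
  function varies continuously, so all its intermediate values occur. Hence it suffices to find such open sets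
  on both sides of the mean. Either no measurable set between A and B is off the mean, and there
  is nothing to do, or one is, its reflection A Un (B - H) is off on the other side, and
  both are approximated by open sets with the prescribed integrals. For 1 and f together this
  approximation first exchanges small pieces of equal measure to get f slightly below and slightly
  above the prescribed value, and then uses the path argument again.
*)

theory Submission
  imports Defs
begin

section \<open>Set integrals as absolutely continuous additive set functions\<close>

context finite_measure
begin

lemma integral_fun_one:
  "A \<in> sets M \<Longrightarrow> integral_fun M (\<lambda>_. 1) A = measure M A"
  unfolding integral_fun_def set_lebesgue_integral_def by simp

lemma set_integrable_integrable:
  fixes \<phi> :: "'a \<Rightarrow> real"
  shows "integrable M \<phi> \<Longrightarrow> A \<in> sets M \<Longrightarrow> set_integrable M A \<phi>"
  unfolding set_integrable_def by (rule integrable_mult_indicator)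

lemma integral_fun_Un:
  assumes "integrable M \<phi>" "A \<in> sets M" "B \<in> sets M" "A \<inter> B = {}"
  shows "integral_fun M \<phi> (A \<union> B) = integral_fun M \<phi> A + integral_fun M \<phi> B"
  unfolding integral_fun_def using assms
  by (intro set_integral_Un set_integrable_integrable) auto

lemma integral_fun_Diff:
  assumes "integrable M \<phi>" "A \<in> sets M" "B \<in> sets M" "B \<subseteq> A"
  shows "integral_fun M \<phi> (A - B) = integral_fun M \<phi> A - integral_fun M \<phi> B"
  using integral_fun_Un[of \<phi> "A - B" B] assms by (simp add: Un_absorb2 Int_commute)

lemma integral_fun_split:
  assumes "integrable M \<phi>" "A \<in> sets M" "B \<in> sets M"
  shows "integral_fun M \<phi> A = integral_fun M \<phi> (A \<inter> B) + integral_fun M \<phi> (A - B)"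
  using integral_fun_Diff[of \<phi> A "A \<inter> B"] assms by (simp add: Diff_Int)

lemma integral_fun_Un_Int:
  assumes "integrable M \<phi>" "A \<in> sets M" "B \<in> sets M"
  shows "integral_fun M \<phi> (A \<union> B) = integral_fun M \<phi> A + integral_fun M \<phi> B - integral_fun M \<phi> (A \<inter> B)"
  using integral_fun_Un[of \<phi> A "B - A"] integral_fun_split[of \<phi> B A] assms
  by (simp add: Int_commute)

lemma integral_fun_uminus:
  "integral_fun M (\<lambda>x. - \<phi> x) A = - integral_fun M \<phi> A"
  unfolding integral_fun_def set_lebesgue_integral_def by simp

text \<open>Truncation splits \<open>\<bar>\<phi> x\<bar>\<close> into a part bounded by
  \<open>n\<close> and a remainder whose total integral is below \<open>\<eta> / 2\<close> for some
  \<open>n\<close>, by dominated convergence. Over \<open>A\<close> the bounded part contributes at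
  most \<open>n\<close> times the measure of \<open>A\<close>.\<close>

lemma integral_fun_absolutely_continuous:
  assumes \<phi>: "integrable M \<phi>" and "\<eta> > 0"
  obtains \<delta> where "\<delta> > 0"
    "\<And>A. A \<in> sets M \<Longrightarrow> measure M A < \<delta> \<Longrightarrow> \<bar>integral_fun M \<phi> A\<bar> < \<eta>"
proof -
  have lim: "(\<lambda>n. LINT x|M. min \<bar>\<phi> x\<bar> (real n)) \<longlonglongrightarrow> (LINT x|M. \<bar>\<phi> x\<bar>)"
  proof (rule integral_dominated_convergence[where w="\<lambda>x. \<bar>\<phi> x\<bar>"])
    show "AE x in M. (\<lambda>n. min \<bar>\<phi> x\<bar> (real n)) \<longlonglongrightarrow> \<bar>\<phi> x\<bar>"
    proof (rule AE_I2)
      fix x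
      obtain N where N: "\<bar>\<phi> x\<bar> \<le> real N" using real_arch_simple by blast
      have "\<forall>\<^sub>F n in sequentially. min \<bar>\<phi> x\<bar> (real n) = \<bar>\<phi> x\<bar>"
        using eventually_ge_at_top[of N] by eventually_elim (use N in linarith)
      then show "(\<lambda>n. min \<bar>\<phi> x\<bar> (real n)) \<longlonglongrightarrow> \<bar>\<phi> x\<bar>"
        by (rule tendsto_eventually)
    qed
  qed (use \<phi> in auto)
  then have "\<forall>\<^sub>F n in sequentially. (LINT x|M. \<bar>\<phi> x\<bar>) - \<eta> / 2 < (LINT x|M. min \<bar>\<phi> x\<bar> (real n))"
    using \<open>\<eta> > 0\<close> by (intro order_tendstoD) auto
  then obtain n where n: "(LINT x|M. \<bar>\<phi> x\<bar>) - \<eta> / 2 < (LINT x|M. min \<bar>\<phi> x\<bar> (real n))"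
    by (auto simp: eventually_sequentially)
  let ?m = "\<lambda>x. min \<bar>\<phi> x\<bar> (real n)"
  have im: "integrable M ?m" using \<phi> by auto
  \<comment> \<open>This threshold keeps the contribution of the bounded part at most
    \<open>\<eta> / 2\<close>; the \<open>+ 1\<close> keeps it meaningful for
    \<open>n = 0\<close>.\<close>
  have bound: "\<bar>integral_fun M \<phi> A\<bar> < \<eta>" if A: "A \<in> sets M" and small: "measure M A < \<eta> / (2 * (real n + 1))" for A
  proof -
    have "\<bar>integral_fun M \<phi> A\<bar> \<le> (LINT x|M. indicator A x * \<bar>\<phi> x\<bar>)"
      unfolding integral_fun_def set_lebesgue_integral_def
      by (rule order_trans[OF integral_abs_bound]) (simp add: abs_mult)
    also have "\<dots> \<le> (LINT x|M. (\<bar>\<phi> x\<bar> - ?m x) + indicator A x * real n)"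
    proof (rule integral_mono)
      show "integrable M (\<lambda>x. indicator A x * \<bar>\<phi> x\<bar>)"
        using integrable_real_mult_indicator[OF A, of "\<lambda>x. \<bar>\<phi> x\<bar>"] \<phi> by (simp add: mult.commute)
      show "integrable M (\<lambda>x. (\<bar>\<phi> x\<bar> - ?m x) + indicator A x * real n)"
        using \<phi> A by (auto simp: emeasure_eq_measure)
    qed (auto split: split_indicator)
    also have "\<dots> = (LINT x|M. \<bar>\<phi> x\<bar>) - (LINT x|M. ?m x) + measure M A * real n"
      using \<phi> A im by (simp add: emeasure_eq_measure)
    also have "\<dots> < \<eta> / 2 + measure M A * real n" using n by simp
    also have "measure M A * real n \<le> measure M A * (real n + 1)"
      by (intro mult_left_mono) auto
    also have "measure M A * (real n + 1) \<le> \<eta> / 2"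
      using small by (simp add: field_simps)
    finally show ?thesis by simp
  qed
  show thesis
    by (rule that[of "\<eta> / (2 * (real n + 1))"]) (use bound \<open>\<eta> > 0\<close> in auto)
qed

text \<open>The contribution of \<open>A \<inter> B\<close> cancels, and absolute continuity with
  \<open>\<eta> / 2\<close> controls each of \<open>A - B\<close> and \<open>B - A\<close>. In this
  form, every later approximation in measure carries over to integrals.\<close>

lemma integral_fun_sym_diff_continuous:
  assumes \<phi>: "integrable M \<phi>" and "\<eta> > 0"
  obtains \<delta> where "\<delta> > 0"
    "\<And>A B. A \<in> sets M \<Longrightarrow> B \<in> sets M \<Longrightarrow> measure M (sym_diff A B) < \<delta>
      \<Longrightarrow> \<bar>integral_fun M \<phi> A - integral_fun M \<phi> B\<bar> < \<eta>"
proof -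
  obtain \<delta> where \<delta>: "\<delta> > 0"
    "\<And>A. A \<in> sets M \<Longrightarrow> measure M A < \<delta> \<Longrightarrow> \<bar>integral_fun M \<phi> A\<bar> < \<eta> / 2"
    using integral_fun_absolutely_continuous[OF \<phi>, of "\<eta> / 2"] \<open>\<eta> > 0\<close> by auto
  show thesis
  proof (rule that[OF \<open>\<delta> > 0\<close>])
    fix A B assume AB: "A \<in> sets M" "B \<in> sets M" and small: "measure M (sym_diff A B) < \<delta>"
    have "measure M (A - B) \<le> measure M (sym_diff A B)" "measure M (B - A) \<le> measure M (sym_diff A B)"
      using AB by (auto intro!: finite_measure_mono)
    then have "\<bar>integral_fun M \<phi> (A - B)\<bar> < \<eta> / 2" "\<bar>integral_fun M \<phi> (B - A)\<bar> < \<eta> / 2"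
      using \<delta>(2) AB small by auto
    moreover have "integral_fun M \<phi> A = integral_fun M \<phi> (A - B) + integral_fun M \<phi> (A \<inter> B)"
      using integral_fun_Diff[OF \<phi>, of A "A \<inter> B"] AB by (simp add: Diff_Int)
    moreover have "integral_fun M \<phi> B = integral_fun M \<phi> (B - A) + integral_fun M \<phi> (A \<inter> B)"
      using integral_fun_Diff[OF \<phi>, of B "A \<inter> B"] AB by (simp add: Diff_Int)
    ultimately show "\<bar>integral_fun M \<phi> A - integral_fun M \<phi> B\<bar> < \<eta>" by linarith
  qed
qed

section \<open>Nonatomic measures: small subsets, intermediate values and exchanges\<close>

lemma nonatomic_small_subset:
  assumes "nonatomic M" "A \<in> sets M" "0 < measure M A" "0 < \<epsilon>"
  obtains B where "B \<in> sets M" "B \<subseteq> A" "0 < measure M B" "measure M B < \<epsilon>"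
proof -
  \<comment> \<open>Nonatomicity splits \<open>A\<close> into two sets of positive measure; one of
    them has at most half of the measure.\<close>
  have half: "\<exists>B\<in>sets M. B \<subseteq> A \<and> 0 < measure M B \<and> measure M B \<le> measure M A / 2"
    if A: "A \<in> sets M" "0 < measure M A" for A
  proof -
    obtain B where B: "B \<in> sets M" "B \<subseteq> A" "0 < measure M B" "measure M B < measure M A"
      using \<open>nonatomic M\<close> A unfolding nonatomic_def
      by (force simp: emeasure_eq_measure ennreal_less_iff)
    have d: "measure M (A - B) = measure M A - measure M B"
      using A B by (intro finite_measure_Diff) auto
    show ?thesis
    proof (cases "measure M B \<le> measure M A / 2")
      case False
      then show ?thesis using A B d by (intro bexI[of _ "A - B"]) auto
    qed (use B in auto)
  qed
  have pow: "\<exists>B\<in>sets M. B \<subseteq> A \<and> 0 < measure M B \<and> measure M B \<le> measure M A / 2 ^ n" for n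
  proof (induction n)
    case (Suc n)
    then obtain B where B: "B \<in> sets M" "B \<subseteq> A" "0 < measure M B" "measure M B \<le> measure M A / 2 ^ n"
      by auto
    obtain C where C: "C \<in> sets M" "C \<subseteq> B" "0 < measure M C" "measure M C \<le> measure M B / 2"
      using half[OF B(1,3)] by auto
    have "measure M C \<le> (measure M A / 2 ^ n) / 2"
      by (rule order_trans[OF C(4)]) (use B(4) in \<open>intro divide_right_mono, auto\<close>)
    then show ?case using B C by (intro bexI[of _ C]) (auto simp: mult.commute)
  qed (use assms in auto)
  obtain n where n: "measure M A / \<epsilon> < 2 ^ n"
    using real_arch_pow[of 2 "measure M A / \<epsilon>"] by auto
  then have "measure M A / 2 ^ n < \<epsilon>" using \<open>\<epsilon> > 0\<close> by (simp add: field_simps)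
  then show thesis using pow[of n] that by force
qed

text \<open>Greedy exhaustion: starting from the empty set, each stage gains at least half of what
  any admissible addition could gain, which is what \<open>Q\<close> records. If the union fell
  short of \<open>c\<close>, a small set of positive measure outside it would be admissible at every
  stage. Each increment would then be at least half its measure, although the increments tend to
  0.\<close>

lemma sierpinski_nonatomic:
  assumes na: "nonatomic M" and A: "A \<in> sets M" and c: "0 \<le> c" "c \<le> measure M A"
  obtains B where "B \<in> sets M" "B \<subseteq> A" "measure M B = c"
proof -
  define P where "P E \<longleftrightarrow> E \<in> sets M \<and> E \<subseteq> A \<and> measure M E \<le> c" for E
  define Q where "Q E E' \<longleftrightarrow> E \<subseteq> E' \<and> (\<forall>B\<in>sets M. B \<subseteq> A - E \<longrightarrow> measure M E + measure M B \<le> c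
      \<longrightarrow> measure M B / 2 \<le> measure M E' - measure M E)" for E E'
  have step: "\<exists>E'. P E' \<and> Q E E'" if E: "P E" for E
  proof -
    \<comment> \<open>The supremum of the admissible gains might not be attained, hence the factor
      one half in \<open>Q\<close>.\<close>
    define S where "S = measure M ` {B\<in>sets M. B \<subseteq> A - E \<and> measure M E + measure M B \<le> c}"
    have S0: "0 \<in> S" using E unfolding S_def P_def by (intro image_eqI[of _ _ "{}"]) auto
    have bdd: "bdd_above S"
    proof (intro bdd_aboveI[of _ c])
      fix x assume "x \<in> S"
      then obtain B where "x = measure M B" "measure M E + measure M B \<le> c"
        unfolding S_def by auto
      then show "x \<le> c" using measure_nonneg[of M E] by linarith
    qed
    show ?thesis
    proof (cases "Sup S > 0")
      case True
      then have "Sup S / 2 < Sup S" by simp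
      then obtain x where "x \<in> S" "Sup S / 2 < x"
        using less_cSupE[of "Sup S / 2" S] S0 by blast
      then obtain B where B: "B \<in> sets M" "B \<subseteq> A - E" "measure M E + measure M B \<le> c" "Sup S / 2 < measure M B"
        unfolding S_def by blast
      have u: "measure M (E \<union> B) = measure M E + measure M B"
        using B E unfolding P_def by (intro finite_measure_Union) auto
      have "P (E \<union> B)" using B E u unfolding P_def by auto
      moreover have "Q E (E \<union> B)"
        unfolding Q_def u
      proof (intro conjI ballI impI)
        fix C assume "C \<in> sets M" "C \<subseteq> A - E" "measure M E + measure M C \<le> c"
        then have "measure M C \<le> Sup S" by (intro cSup_upper[OF _ bdd]) (auto simp: S_def)
        then show "measure M C / 2 \<le> measure M E + measure M B - measure M E" using B(4) by linarith
      qed auto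
      ultimately show ?thesis by blast
    next
      case False
      \<comment> \<open>Every admissible addition is null here, so the construction may stand
        still.\<close>
      have "Q E E"
        unfolding Q_def
      proof (intro conjI ballI impI)
        fix C assume "C \<in> sets M" "C \<subseteq> A - E" "measure M E + measure M C \<le> c"
        then have "measure M C \<le> Sup S" by (intro cSup_upper[OF _ bdd]) (auto simp: S_def)
        then show "measure M C / 2 \<le> measure M E - measure M E" using False by linarith
      qed auto
      then show ?thesis using E by blast
    qed
  qed
  have "P {}" using c by (auto simp: P_def)
  then obtain E where E: "\<And>n. P (E n)" "\<And>n. Q (E n) (E (Suc n))"
    using dependent_nat_choice[of "\<lambda>_. P" "\<lambda>_. Q"] step by metis
  let ?E = "\<Union>n. E n"
  have inc: "incseq E" using E(2) unfolding Q_def by (intro incseq_SucI) auto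
  have meas: "range E \<subseteq> sets M" "?E \<in> sets M" "?E \<subseteq> A" using E(1) unfolding P_def by auto
  have lim: "(\<lambda>n. measure M (E n)) \<longlonglongrightarrow> measure M ?E"
    by (rule finite_Lim_measure_incseq[OF meas(1) inc])
  have le: "measure M ?E \<le> c"
    by (rule LIMSEQ_le_const2[OF lim]) (use E(1) in \<open>auto simp: P_def\<close>)
  have "measure M ?E = c"
  proof (rule ccontr)
    assume "measure M ?E \<noteq> c"
    then have lt: "measure M ?E < c" using le by simp
    have "measure M (A - ?E) = measure M A - measure M ?E"
      using A meas by (intro finite_measure_Diff) auto
    then have "0 < measure M (A - ?E)" using lt c by simp
    then obtain B where B: "B \<in> sets M" "B \<subseteq> A - ?E" "0 < measure M B" "measure M B < c - measure M ?E"
      using nonatomic_small_subset[OF na, of "A - ?E" "c - measure M ?E"] A meas lt by auto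
    have "measure M B / 2 \<le> measure M (E (Suc n)) - measure M (E n)" for n
    proof -
      have "measure M (E n) \<le> measure M ?E" using meas by (intro finite_measure_mono) auto
      then have "measure M (E n) + measure M B \<le> c" using B(4) by simp
      then show ?thesis using E(2)[of n] B unfolding Q_def by blast
    qed
    moreover have "(\<lambda>n. measure M (E (Suc n)) - measure M (E n)) \<longlonglongrightarrow> measure M ?E - measure M ?E"
      by (intro tendsto_diff LIMSEQ_Suc lim)
    ultimately have "measure M B / 2 \<le> 0"
      by (intro LIMSEQ_le_const[of "\<lambda>n. measure M (E (Suc n)) - measure M (E n)"]) auto
    then show False using B(3) by simp
  qed
  then show thesis using that meas by blast
qed

text \<open>Cut both sets into halves of equal measure. The gap between the two integrals is the sum
  of the gaps of the two pairs of halves, so at least one pair keeps a positive gap. Iterating makes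
  the measure as small as desired.\<close>

lemma exchange_small_pieces:
  assumes na: "nonatomic M" and f: "integrable M f"
    and DE: "D \<in> sets M" "E \<in> sets M" "measure M D = measure M E"
    and less: "integral_fun M f E < integral_fun M f D" and "0 < \<epsilon>"
  obtains A B where "A \<in> sets M" "A \<subseteq> D" "B \<in> sets M" "B \<subseteq> E" "measure M A = measure M B"
    "measure M A < \<epsilon>" "integral_fun M f B < integral_fun M f A"
proof -
  have "\<exists>A\<in>sets M. \<exists>B\<in>sets M. A \<subseteq> D \<and> B \<subseteq> E \<and> measure M A = measure M D / 2 ^ n \<and>
      measure M B = measure M D / 2 ^ n \<and> integral_fun M f B < integral_fun M f A" for n
  proof (induction n)
    case (Suc n)
    then obtain A B where AB: "A \<in> sets M" "B \<in> sets M" "A \<subseteq> D" "B \<subseteq> E"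
      "measure M A = measure M D / 2 ^ n" "measure M B = measure M D / 2 ^ n"
      "integral_fun M f B < integral_fun M f A" by auto
    obtain A1 where A1: "A1 \<in> sets M" "A1 \<subseteq> A" "measure M A1 = measure M A / 2"
      using sierpinski_nonatomic[OF na AB(1), of "measure M A / 2"] by auto
    obtain B1 where B1: "B1 \<in> sets M" "B1 \<subseteq> B" "measure M B1 = measure M B / 2"
      using sierpinski_nonatomic[OF na AB(2), of "measure M B / 2"] by auto
    have I: "integral_fun M f (A - A1) = integral_fun M f A - integral_fun M f A1"
      "integral_fun M f (B - B1) = integral_fun M f B - integral_fun M f B1"
      using AB A1 B1 by (auto intro!: integral_fun_Diff f)
    have m: "measure M (A - A1) = measure M A / 2" "measure M (B - B1) = measure M B / 2"
      using AB A1 B1 by (auto simp: finite_measure_Diff)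
    show ?case
    proof (cases "integral_fun M f B1 < integral_fun M f A1")
      case True
      show ?thesis
        by (rule bexI[of _ A1], rule bexI[of _ B1]) (use AB A1 B1 True in auto)
    next
      case False
      show ?thesis
        by (rule bexI[of _ "A - A1"], rule bexI[of _ "B - B1"]) (use AB A1 B1 False I m in auto)
    qed
  qed (use DE less in auto)
  note * = this
  obtain n where n: "measure M D / \<epsilon> < 2 ^ n"
    using real_arch_pow[of 2 "measure M D / \<epsilon>"] by auto
  then have "measure M D / 2 ^ n < \<epsilon>" using \<open>\<epsilon> > 0\<close> by (simp add: field_simps)
  then show thesis using *[of n] that by force
qed

end


text \<open>At level \<open>n\<close> the indices 0 to \<open>2 ^ n\<close> run through a chain from
  \<open>a\<close> to \<open>b\<close>: even indices repeat the previous level and odd ones insert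
  midpoints. Level 0 sends every positive index to \<open>b\<close>, so that monotonicity in the
  index can be stated without an upper bound.\<close>

primrec bisect :: "('b \<Rightarrow> 'b \<Rightarrow> 'b) \<Rightarrow> 'b \<Rightarrow> 'b \<Rightarrow> nat \<Rightarrow> nat \<Rightarrow> 'b" where
  "bisect mid a b 0 = (\<lambda>k. if k = 0 then a else b)"
| "bisect mid a b (Suc n) = (\<lambda>k. if even k then bisect mid a b n (k div 2)
     else mid (bisect mid a b n (k div 2)) (bisect mid a b n (Suc (k div 2))))"

section \<open>Open sets of prescribed measure\<close>

locale nonatomic_regular_measure = finite_measure M for M :: "'a measure" +
  fixes X :: "'a topology"
  assumes openin_sets: "openin X U \<Longrightarrow> U \<in> sets M"
    and nonatomic: "nonatomic M"
    and weakly_outer_regular: "weakly_outer_regular X M"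
begin

lemma open_cover_ae:
  assumes "A \<in> sets M" "\<epsilon> > 0"
  obtains U where "openin X U" "measure M (A - U) = 0" "measure M (U - A) < \<epsilon>"
  using weakly_outer_regular assms unfolding weakly_outer_regular_def
  by (auto simp: emeasure_eq_measure ennreal_less_iff)

text \<open>Replacing a cover \<open>V\<close> of \<open>H\<close> by
  \<open>A \<union> V \<inter> B\<close> puts it between \<open>A\<close> and \<open>B\<close>, and
  because \<open>A \<subseteq> H \<subseteq> B\<close> this increases neither error.\<close>

lemma open_cover_between:
  assumes A: "openin X A" and B: "openin X B" and H: "H \<in> sets M" "A \<subseteq> H" "H \<subseteq> B" and "\<epsilon> > 0"
  obtains U where "openin X U" "A \<subseteq> U" "U \<subseteq> B" "measure M (H - U) = 0" "measure M (U - H) < \<epsilon>"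
proof -
  obtain V where V: "openin X V" "measure M (H - V) = 0" "measure M (V - H) < \<epsilon>"
    using open_cover_ae[OF H(1) \<open>\<epsilon> > 0\<close>] .
  have [measurable]: "A \<in> sets M" "B \<in> sets M" "V \<in> sets M" using A B V openin_sets by auto
  have "measure M (H - (A \<union> V \<inter> B)) \<le> measure M (H - V)"
    using H by (intro finite_measure_mono) auto
  moreover have "measure M ((A \<union> V \<inter> B) - H) \<le> measure M (V - H)"
    using H by (intro finite_measure_mono) auto
  ultimately show thesis
    using that[of "A \<union> V \<inter> B"] V A B H by (auto simp: measure_le_0_iff)
qed

lemma measure_Un_disjoint_diff:
  assumes "A \<in> sets M" "H \<in> sets M"
  shows "measure M A = measure M (A \<inter> H) + measure M (A - H)"
  using finite_measure_Diff[of A "A \<inter> H"] assms by (simp add: Diff_Int)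

text \<open>The value \<open>c\<close> is approached from below, since increasing unions of open
  sets stay open. Each step at least halves the deficit without overshooting.\<close>

lemma open_exact_measure:
  assumes A: "openin X A" and B: "openin X B" "A \<subseteq> B" and c: "measure M A \<le> c" "c \<le> measure M B"
  obtains U where "openin X U" "A \<subseteq> U" "U \<subseteq> B" "measure M U = c"
proof -
  define P where "P U \<longleftrightarrow> openin X U \<and> A \<subseteq> U \<and> U \<subseteq> B \<and> measure M U \<le> c" for U
  define Q where "Q U V \<longleftrightarrow> U \<subseteq> V \<and> (c + measure M U) / 2 \<le> measure M V" for U V
  have step: "\<exists>V. P V \<and> Q U V" if U: "P U" for U
  proof (cases "measure M U = c")
    case True
    then show ?thesis using U unfolding Q_def by (intro exI[of _ U]) auto
  next
    case False
    then have lt: "measure M U < c" using U unfolding P_def by simp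
    have s: "U \<in> sets M" "B \<in> sets M" using U B openin_sets unfolding P_def by auto
    have "measure M (B - U) = measure M B - measure M U"
      using U s unfolding P_def by (intro finite_measure_Diff) auto
    \<comment> \<open>Half of the deficit is filled by \<open>D\<close>; the other half is the room
      left for the excess of an open cover of \<open>U \<union> D\<close>.\<close>
    then obtain D where D: "D \<in> sets M" "D \<subseteq> B - U" "measure M D = (c - measure M U) / 2"
      using sierpinski_nonatomic[OF nonatomic, of "B - U" "(c - measure M U) / 2"] lt c s by auto
    have m: "measure M (U \<union> D) = (c + measure M U) / 2"
      using finite_measure_Union[of U D] D s by (auto simp: field_simps)
    obtain V where V: "openin X V" "U \<subseteq> V" "V \<subseteq> B" "measure M ((U \<union> D) - V) = 0"
      "measure M (V - (U \<union> D)) < (c - measure M U) / 2"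
      using open_cover_between[of U B "U \<union> D" "(c - measure M U) / 2"] U B D s lt unfolding P_def by auto
    have v: "V \<in> sets M" "U \<union> D \<in> sets M" using V openin_sets s D by auto
    have "measure M V = measure M (V \<inter> (U \<union> D)) + measure M (V - (U \<union> D))"
      "measure M (U \<union> D) = measure M (V \<inter> (U \<union> D)) + measure M ((U \<union> D) - V)"
      using measure_Un_disjoint_diff[OF v] measure_Un_disjoint_diff[OF v(2,1)] by (auto simp: Int_commute)
    moreover have "(c + measure M U) / 2 + (c - measure M U) / 2 = c" by (simp add: field_simps)
    ultimately have "(c + measure M U) / 2 \<le> measure M V \<and> measure M V \<le> c"
      using V(4,5) m measure_nonneg[of M "V - (U \<union> D)"] by linarith
    then show ?thesis using V U unfolding P_def Q_def by (intro exI[of _ V]) auto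
  qed
  have "P A" using A B c by (auto simp: P_def)
  then obtain E where E: "\<And>n. P (E n)" "\<And>n. Q (E n) (E (Suc n))"
    using dependent_nat_choice[of "\<lambda>_. P" "\<lambda>_. Q"] step by metis
  have inc: "incseq E" using E(2) unfolding Q_def by (intro incseq_SucI) auto
  have meas: "range E \<subseteq> sets M" using E(1) openin_sets unfolding P_def by auto
  have lim: "(\<lambda>n. measure M (E n)) \<longlonglongrightarrow> measure M (\<Union>n. E n)"
    by (rule finite_Lim_measure_incseq[OF meas inc])
  \<comment> \<open>Passing to the limit in \<open>Q\<close> shows that the deficit of the union is
    at most half of itself, hence not positive.\<close>
  have "(c + measure M (\<Union>n. E n)) / 2 \<le> measure M (\<Union>n. E n)"
  proof (rule LIMSEQ_le)
    show "(\<lambda>n. (c + measure M (E n)) / 2) \<longlonglongrightarrow> (c + measure M (\<Union>n. E n)) / 2"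
      by (intro tendsto_intros lim) auto
    show "(\<lambda>n. measure M (E (Suc n))) \<longlonglongrightarrow> measure M (\<Union>n. E n)"
      by (intro LIMSEQ_Suc lim)
  qed (use E(2) in \<open>auto simp: Q_def\<close>)
  moreover have "measure M (\<Union>n. E n) \<le> c"
    by (rule LIMSEQ_le_const2[OF lim]) (use E(1) in \<open>auto simp: P_def\<close>)
  ultimately have "measure M (\<Union>n. E n) = c" by simp
  then show thesis
    using that[of "\<Union>n. E n"] E(1) unfolding P_def by (auto intro!: openin_Union)
qed

text \<open>An open cover of \<open>H\<close> may have too much measure. Therefore \<open>H\<close>
  is first shrunk by \<open>\<delta>\<close> to a set \<open>A \<union> D\<close>, covered with
  excess below \<open>\<delta>\<close>, and the cover is then enlarged to the exact measure. At most
  \<open>\<delta>\<close> of \<open>H\<close> is missed, and equality of measures makes the surplus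
  outside \<open>H\<close> equally small.\<close>

lemma open_approx_exact_measure:
  assumes A: "openin X A" and B: "openin X B" and H: "H \<in> sets M" "A \<subseteq> H" "H \<subseteq> B" and "\<epsilon> > 0"
  obtains U where "openin X U" "A \<subseteq> U" "U \<subseteq> B" "measure M U = measure M H"
    "measure M (sym_diff U H) < \<epsilon>"
proof -
  have s: "A \<in> sets M" "B \<in> sets M" using A B openin_sets by auto
  \<comment> \<open>Only \<open>H - A\<close> can be shrunk, which explains the second bound; the
    first one gives \<open>2 * \<delta> < \<epsilon>\<close>.\<close>
  define \<delta> where "\<delta> = min (\<epsilon> / 3) (measure M H - measure M A)"
  have mHA: "measure M A \<le> measure M H" "measure M H \<le> measure M B"
    using H s by (auto intro!: finite_measure_mono)
  have d: "0 \<le> \<delta>" "2 * \<delta> < \<epsilon>" "\<delta> \<le> measure M H - measure M A"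
    using mHA \<open>\<epsilon> > 0\<close> unfolding \<delta>_def by (auto simp: min_def)
  have "measure M (H - A) = measure M H - measure M A"
    using H s by (intro finite_measure_Diff) auto
  then obtain D where D: "D \<in> sets M" "D \<subseteq> H - A" "measure M D = measure M H - measure M A - \<delta>"
    using sierpinski_nonatomic[OF nonatomic, of "H - A" "measure M H - measure M A - \<delta>"] d H s by auto
  let ?K = "A \<union> D"
  have K: "?K \<in> sets M" "A \<subseteq> ?K" "?K \<subseteq> B" "?K \<subseteq> H" using D s H by auto
  have mK: "measure M ?K = measure M H - \<delta>"
    using finite_measure_Union[of A D] D s by auto
  obtain V where V: "openin X V" "A \<subseteq> V" "V \<subseteq> B" "measure M (?K - V) = 0" "measure M V \<le> measure M H"
  proof (cases "\<delta> = 0")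
    \<comment> \<open>Without room for a positive excess, \<open>H\<close> exceeds \<open>A\<close>
      by a null set only, and \<open>A\<close> itself serves as the cover.\<close>
    case True
    then have "measure M H = measure M A" using mHA \<open>\<epsilon> > 0\<close> unfolding \<delta>_def by (auto simp: min_def split: if_splits)
    moreover from this have "measure M (?K - A) = 0"
      using True finite_measure_Diff[of ?K A] K mK s by auto
    ultimately show thesis using that[of A] A H by auto
  next
    case False
    then obtain V where V: "openin X V" "A \<subseteq> V" "V \<subseteq> B" "measure M (?K - V) = 0" "measure M (V - ?K) < \<delta>"
      using open_cover_between[OF A B K(1-3), of \<delta>] d by auto
    have v: "V \<in> sets M" using V openin_sets by auto
    have "measure M V = measure M (V \<inter> ?K) + measure M (V - ?K)"
      "measure M ?K = measure M (V \<inter> ?K) + measure M (?K - V)"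
      using measure_Un_disjoint_diff[OF v K(1)] measure_Un_disjoint_diff[OF K(1) v] by (auto simp: Int_commute)
    then have "measure M V \<le> measure M H" using V mK by linarith
    then show thesis using that V by blast
  qed
  obtain U where U: "openin X U" "V \<subseteq> U" "U \<subseteq> B" "measure M U = measure M H"
    using open_exact_measure[OF V(1) B V(3), of "measure M H"] V mHA by auto
  have u: "U \<in> sets M" "V \<in> sets M" using U V openin_sets by auto
  have "measure M (H - U) \<le> measure M ((H - ?K) \<union> (?K - V))"
    using U H K u by (intro finite_measure_mono) auto
  also have "\<dots> \<le> measure M (H - ?K) + measure M (?K - V)"
    using H K u by (intro measure_Un_le) auto
  also have "\<dots> = \<delta>" using V finite_measure_Diff[of H ?K] K H mK by auto
  finally have HU: "measure M (H - U) \<le> \<delta>" .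
  have "measure M (U - H) = measure M (H - U)"
    using measure_Un_disjoint_diff[OF u(1) H(1)] measure_Un_disjoint_diff[OF H(1) u(1)] U(4)
    by (auto simp: Int_commute)
  moreover have "measure M (sym_diff U H) \<le> measure M (U - H) + measure M (H - U)"
    using H u by (intro measure_Un_le) auto
  ultimately have "measure M (sym_diff U H) < \<epsilon>" using HU d by linarith
  then show thesis using that[of U] U V by auto
qed

section \<open>Halving, chains and approximation for several integrals at once\<close>

definition open_halving :: "('a \<Rightarrow> real) set \<Rightarrow> bool" where
  "open_halving \<Phi> \<longleftrightarrow> (\<forall>A B. openin X A \<longrightarrow> openin X B \<longrightarrow> A \<subseteq> B \<longrightarrow>
     (\<exists>C. openin X C \<and> A \<subseteq> C \<and> C \<subseteq> B \<and>
       (\<forall>\<phi>\<in>\<Phi>. integral_fun M \<phi> C = (integral_fun M \<phi> A + integral_fun M \<phi> B) / 2)))"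

text \<open>From the empty set to the whole space, this is a common O-segment for all functions in
  \<open>\<Phi>\<close>; general endpoints are needed for the path argument.\<close>

definition open_chain :: "('a \<Rightarrow> real) set \<Rightarrow> 'a set \<Rightarrow> 'a set \<Rightarrow> (real \<Rightarrow> 'a set) \<Rightarrow> bool" where
  "open_chain \<Phi> A B u \<longleftrightarrow> (\<forall>t\<in>{0..1}. openin X (u t)) \<and> u 0 = A \<and> u 1 = B \<and>
     (\<forall>s\<in>{0..1}. \<forall>t\<in>{0..1}. s \<le> t \<longrightarrow> u s \<subseteq> u t) \<and>
     (\<forall>\<phi>\<in>\<Phi>. \<forall>t\<in>{0..1}. integral_fun M \<phi> (u t) =
        integral_fun M \<phi> A + t * (integral_fun M \<phi> B - integral_fun M \<phi> A))"

text \<open>Only sets \<open>H\<close> with mean integrals are approximated. These are the sets met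
  in the halving step, and the mean condition lets reflection preserve the prescribed
  integrals.\<close>

definition open_approx :: "('a \<Rightarrow> real) set \<Rightarrow> bool" where
  "open_approx \<Phi> \<longleftrightarrow> (\<forall>A B H \<epsilon>. openin X A \<longrightarrow> openin X B \<longrightarrow> H \<in> sets M \<longrightarrow> A \<subseteq> H \<longrightarrow> H \<subseteq> B \<longrightarrow>
     (\<forall>\<phi>\<in>\<Phi>. integral_fun M \<phi> H = (integral_fun M \<phi> A + integral_fun M \<phi> B) / 2) \<longrightarrow> \<epsilon> > 0 \<longrightarrow>
     (\<exists>U. openin X U \<and> A \<subseteq> U \<and> U \<subseteq> B \<and> (\<forall>\<phi>\<in>\<Phi>. integral_fun M \<phi> U = integral_fun M \<phi> H) \<and>
       measure M (sym_diff U H) < \<epsilon>))"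

text \<open>Iterated halving gives sets with affine integrals at dyadic parameters. At a general
  \<open>t\<close> the union over dyadic approximations from below is taken: it is open, and
  continuity of the integral along increasing sets carries the affine formula to the limit.\<close>

lemma open_halving_imp_chain:
  assumes h: "open_halving \<Phi>" and \<Phi>: "\<forall>\<phi>\<in>\<Phi>. integrable M \<phi>"
    and AB: "openin X A" "openin X B" "A \<subseteq> B"
  obtains u where "open_chain \<Phi> A B u"
proof -
  obtain mid where mid: "\<And>A B. openin X A \<Longrightarrow> openin X B \<Longrightarrow> A \<subseteq> B \<Longrightarrow>
      openin X (mid A B) \<and> A \<subseteq> mid A B \<and> mid A B \<subseteq> B \<and>
      (\<forall>\<phi>\<in>\<Phi>. integral_fun M \<phi> (mid A B) = (integral_fun M \<phi> A + integral_fun M \<phi> B) / 2)"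
    using h unfolding open_halving_def by metis
  let ?I = "integral_fun M"
  let ?v = "bisect mid A B"
  have v: "openin X (?v n k) \<and> ?v n k \<subseteq> ?v n (Suc k)" for n k
  proof (induction n arbitrary: k)
    case (Suc n)
    show ?case
    proof (cases "even k")
      case True
      then show ?thesis using Suc[of "k div 2"] mid[of "?v n (k div 2)" "?v n (Suc (k div 2))"] Suc[of "Suc (k div 2)"]
        by auto
    next
      case False
      then have "Suc k div 2 = Suc (k div 2)" by presburger
      then show ?thesis using False Suc[of "k div 2"] mid[of "?v n (k div 2)" "?v n (Suc (k div 2))"] Suc[of "Suc (k div 2)"]
        by auto
    qed
  qed (use AB in auto)
  have mono: "?v n j \<subseteq> ?v n k" if "j \<le> k" for n j k
    using lift_Suc_mono_le[of "?v n" j k] v that by blast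
  \<comment> \<open>The bound on \<open>k\<close> matters: from index \<open>2 ^ n\<close> on, the
    sets stay at \<open>B\<close>.\<close>
  have val: "?I \<phi> (?v n k) = ?I \<phi> A + real k / 2 ^ n * (?I \<phi> B - ?I \<phi> A)"
    if "\<phi> \<in> \<Phi>" "k \<le> 2 ^ n" for \<phi> n k
    using \<open>k \<le> 2 ^ n\<close>
  proof (induction n arbitrary: k)
    case 0
    then have "k = 0 \<or> k = 1" by auto
    then show ?case by auto
  next
    case (Suc n)
    show ?case
    proof (cases "even k")
      case True
      then obtain j where "k = 2 * j" by auto
      then show ?thesis using Suc by simp
    next
      case False
      then obtain j where j: "k = 2 * j + 1" by (auto elim: oddE)
      then have "j \<le> 2 ^ n" "Suc j \<le> 2 ^ n" using Suc.prems by auto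
      then have "?I \<phi> (?v n j) = ?I \<phi> A + real j / 2 ^ n * (?I \<phi> B - ?I \<phi> A)"
        "?I \<phi> (?v n (Suc j)) = ?I \<phi> A + real (Suc j) / 2 ^ n * (?I \<phi> B - ?I \<phi> A)"
        using Suc.IH by blast+
      moreover have "?I \<phi> (?v (Suc n) k) = (?I \<phi> (?v n j) + ?I \<phi> (?v n (Suc j))) / 2"
        using j mid[of "?v n j" "?v n (Suc j)"] v[of n j] v[of n "Suc j"] that(1) by simp
      moreover have "(a + p * d + (a + q * d)) / 2 = a + (p + q) / 2 * d" for a p q d :: real
        by (simp add: field_simps)
      ultimately have "?I \<phi> (?v (Suc n) k) = ?I \<phi> A + (real j / 2 ^ n + real (Suc j) / 2 ^ n) / 2 * (?I \<phi> B - ?I \<phi> A)"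
        by presburger
      moreover have "(real j / 2 ^ n + real (Suc j) / 2 ^ n) / 2 = real k / 2 ^ Suc n"
        using j by (simp add: field_simps)
      ultimately show ?thesis by presburger
    qed
  qed
  \<comment> \<open>For \<open>t\<close> in the unit interval, \<open>fl n t / 2 ^ n\<close> is the
    largest dyadic number of level \<open>n\<close> not exceeding \<open>t\<close>.\<close>
  define fl where "fl n t = nat \<lfloor>t * 2 ^ n\<rfloor>" for n and t :: real
  have fl_le: "fl n t \<le> 2 ^ n" if "t \<in> {0..1}" for n t
  proof -
    have "t * 2 ^ n \<le> 1 * 2 ^ n" using that by (intro mult_right_mono) auto
    then have "t * 2 ^ n < 2 ^ n + 1" by linarith
    then have "\<lfloor>t * 2 ^ n\<rfloor> \<le> 2 ^ n" by (simp add: floor_le_iff)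
    then show ?thesis unfolding fl_def by (simp add: nat_le_iff)
  qed
  define u where "u t = (\<Union>n. ?v n (fl n t))" for t
  have inc: "incseq (\<lambda>n. ?v n (fl n t))" if "t \<in> {0..1}" for t
  proof (rule incseq_SucI)
    fix n
    \<comment> \<open>Index \<open>k\<close> at level \<open>n\<close> is index \<open>2 * k\<close>
      at the next level, so this inequality makes the approximating sets increase with
      \<open>n\<close>.\<close>
    have "2 * \<lfloor>t * 2 ^ n\<rfloor> \<le> \<lfloor>t * 2 ^ Suc n\<rfloor>"
      by (simp add: le_floor_iff mult.assoc mult.left_commute[of t])
    then have "2 * fl n t \<le> fl (Suc n) t" using that unfolding fl_def by linarith
    then have "?v (Suc n) (2 * fl n t) \<subseteq> ?v (Suc n) (fl (Suc n) t)" by (rule mono)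
    then show "?v n (fl n t) \<subseteq> ?v (Suc n) (fl (Suc n) t)" by simp
  qed
  have flim: "(\<lambda>n. real (fl n t) / 2 ^ n) \<longlonglongrightarrow> t" if "t \<in> {0..1}" for t
  proof (rule tendsto_sandwich)
    have nn: "0 \<le> t * 2 ^ n" for n :: nat using that by simp
    have fl: "real (fl n t) = of_int \<lfloor>t * 2 ^ n\<rfloor>" for n
      using nn[of n] unfolding fl_def by simp
    show "\<forall>\<^sub>F n in sequentially. real (fl n t) / 2 ^ n \<le> t"
      unfolding fl by (intro always_eventually allI) (simp add: field_simps)
    show "\<forall>\<^sub>F n in sequentially. t - (1 / 2) ^ n \<le> real (fl n t) / 2 ^ n"
    proof (intro always_eventually allI)
      fix n :: nat
      have "t * 2 ^ n - 1 \<le> real (fl n t)" unfolding fl by linarith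
      then have "(t * 2 ^ n - 1) / 2 ^ n \<le> real (fl n t) / 2 ^ n" by (intro divide_right_mono) auto
      then show "t - (1 / 2) ^ n \<le> real (fl n t) / 2 ^ n" by (simp add: diff_divide_distrib power_divide)
    qed
    have "(\<lambda>n. t - (1 / 2) ^ n) \<longlonglongrightarrow> t - 0" by (intro tendsto_intros LIMSEQ_power_zero) auto
    then show "(\<lambda>n. t - (1 / 2) ^ n) \<longlonglongrightarrow> t" by simp
  qed auto
  have "open_chain \<Phi> A B u"
    unfolding open_chain_def
  proof (intro conjI ballI impI)
    fix t :: real assume t: "t \<in> {0..1}"
    show "openin X (u t)" unfolding u_def using v by (auto intro!: openin_Union)
    fix \<phi> assume \<phi>: "\<phi> \<in> \<Phi>"
    have s: "?v n k \<in> sets M" for n k using v openin_sets by auto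
    have 1: "(\<lambda>n. ?I \<phi> (?v n (fl n t))) \<longlonglongrightarrow> ?I \<phi> (u t)"
      unfolding integral_fun_def u_def
      using s inc[OF t] \<Phi>[rule_format, OF \<phi>]
      by (intro set_integral_cont_up set_integrable_integrable) auto
    have 2: "(\<lambda>n. ?I \<phi> (?v n (fl n t))) \<longlonglongrightarrow> ?I \<phi> A + t * (?I \<phi> B - ?I \<phi> A)"
      unfolding val[OF \<phi> fl_le[OF t]] by (intro tendsto_intros flim t)
    show "?I \<phi> (u t) = ?I \<phi> A + t * (?I \<phi> B - ?I \<phi> A)"
      by (rule LIMSEQ_unique[OF 1 2])
  next
    have "?v n 0 = A" for n by (induction n) auto
    then show "u 0 = A" unfolding u_def fl_def by simp
    have "?v n (2 ^ n) = B" for n by (induction n) auto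
    \<comment> \<open>At \<open>t = 1\<close> the approximation is exact at every level, so the
      union is \<open>B\<close> itself.\<close>
    moreover have "fl n 1 = 2 ^ n" for n
    proof -
      have "(1::real) * 2 ^ n = of_nat (2 ^ n)" by simp
      then show ?thesis unfolding fl_def by (simp only: floor_of_nat nat_int)
    qed
    ultimately show "u 1 = B" unfolding u_def by simp
  next
    fix s t :: real assume "s \<in> {0..1}" "t \<in> {0..1}" "s \<le> t"
    then have "fl n s \<le> fl n t" for n
      unfolding fl_def by (intro nat_mono floor_mono mult_right_mono) auto
    then show "u s \<subseteq> u t" unfolding u_def using mono by blast
  qed
  then show thesis by (rule that)
qed

section \<open>Continuity along chains and the path argument\<close>

lemma open_chain_continuous:
  assumes u: "open_chain \<Phi> A B u" and one: "(\<lambda>_. 1) \<in> \<Phi>" and g: "integrable M g"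
  shows "continuous_on {0..1} (\<lambda>t. integral_fun M g (u t))"
proof -
  have s: "u t \<in> sets M" if "t \<in> {0..1}" for t using u that openin_sets unfolding open_chain_def by auto
  define d where "d = measure M B - measure M A"
  have A: "A = u 0" "B = u 1" using u unfolding open_chain_def by auto
  have "A \<subseteq> B" using u unfolding A open_chain_def by auto
  then have d: "d \<ge> 0" unfolding d_def using s[of 1] A(2) by (simp add: finite_measure_mono)
  have m: "measure M (u t) = measure M A + t * d" if "t \<in> {0..1}" for t
  proof -
    have "integral_fun M (\<lambda>_. 1) (u t) =
        integral_fun M (\<lambda>_. 1) A + t * (integral_fun M (\<lambda>_. 1) B - integral_fun M (\<lambda>_. 1) A)"
      using u one that unfolding open_chain_def by blast
    then show ?thesis using s[OF that] s[of 0] s[of 1] unfolding A d_def by (simp add: integral_fun_one)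
  qed
  \<comment> \<open>Since the constant 1 belongs to \<open>\<Phi>\<close>, measure is affine along
    the chain, and nested members differ by a set of measure proportional to the parameter
    distance.\<close>
  have sd: "measure M (sym_diff (u r) (u t)) = (t - r) * d" if "r \<in> {0..1}" "t \<in> {0..1}" "r \<le> t" for r t
  proof -
    have "u r \<subseteq> u t" using u that unfolding open_chain_def by blast
    then have "sym_diff (u r) (u t) = u t - u r" by auto
    then show ?thesis using finite_measure_Diff[OF s[OF that(2)] s[OF that(1)] \<open>u r \<subseteq> u t\<close>] m that
      by (simp add: algebra_simps)
  qed
  show ?thesis
    unfolding continuous_on_iff
  proof (intro ballI allI impI)
    fix t \<eta> :: real assume t: "t \<in> {0..1}" and "\<eta> > 0"
    obtain \<delta> where \<delta>: "\<delta> > 0" "\<And>A B. A \<in> sets M \<Longrightarrow> B \<in> sets M \<Longrightarrow> measure M (sym_diff A B) < \<delta>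
      \<Longrightarrow> \<bar>integral_fun M g A - integral_fun M g B\<bar> < \<eta>"
      using integral_fun_sym_diff_continuous[OF g \<open>\<eta> > 0\<close>] by blast
    show "\<exists>e>0. \<forall>r\<in>{0..1}. dist r t < e \<longrightarrow> dist (integral_fun M g (u r)) (integral_fun M g (u t)) < \<eta>"
    \<comment> \<open>Adding 1 covers the case \<open>d = 0\<close>.\<close>
    proof (intro exI[of _ "\<delta> / (d + 1)"] conjI ballI impI)
      show "\<delta> / (d + 1) > 0" using \<delta> d by simp
      fix r :: real assume r: "r \<in> {0..1}" and dist: "dist r t < \<delta> / (d + 1)"
      have "\<bar>r - t\<bar> * d \<le> \<bar>r - t\<bar> * (d + 1)" by (simp add: mult_left_mono)
      also have "\<dots> < \<delta>" using dist d by (simp add: dist_real_def field_simps)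
      finally have lt: "\<bar>r - t\<bar> * d < \<delta>" .
      have "measure M (sym_diff (u r) (u t)) < \<delta>"
        using lt sd[of r t] sd[of t r] r t by (cases "r \<le> t") (auto simp: Un_commute)
      then show "dist (integral_fun M g (u r)) (integral_fun M g (u t)) < \<eta>"
        using \<delta>(2) s r t by (simp add: dist_real_def)
    qed
  qed
qed

text \<open>One chain grows from \<open>U \<inter> U'\<close> to \<open>U'\<close> while the other
  shrinks from \<open>U\<close> back to \<open>U \<inter> U'\<close>. Members of the two chains
  always meet in exactly \<open>U \<inter> U'\<close>, so integrals over their union follow by
  inclusion-exclusion. For functions in \<open>\<Phi>\<close> the affine changes cancel, because the
  integrals over \<open>U\<close> and \<open>U'\<close> agree.\<close>

lemma open_path:
  assumes h: "open_halving \<Phi>" and \<Phi>: "\<forall>\<phi>\<in>\<Phi>. integrable M \<phi>" and one: "(\<lambda>_. 1) \<in> \<Phi>"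
    and g: "integrable M g" and U: "openin X U" "openin X U'"
    and eq: "\<And>\<phi>. \<phi> \<in> \<Phi> \<Longrightarrow> integral_fun M \<phi> U = integral_fun M \<phi> U'"
    and c: "integral_fun M g U \<le> c" "c \<le> integral_fun M g U'"
  obtains W where "openin X W" "U \<inter> U' \<subseteq> W" "W \<subseteq> U \<union> U'"
    "\<And>\<phi>. \<phi> \<in> \<Phi> \<Longrightarrow> integral_fun M \<phi> W = integral_fun M \<phi> U" "integral_fun M g W = c"
proof -
  let ?I = "integral_fun M"
  obtain a where a: "open_chain \<Phi> (U \<inter> U') U' a"
    using open_halving_imp_chain[OF h \<Phi>, of "U \<inter> U'" U'] U by auto
  obtain b where b: "open_chain \<Phi> (U \<inter> U') U b"
    using open_halving_imp_chain[OF h \<Phi>, of "U \<inter> U'" U] U by auto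
  have bet: "U \<inter> U' \<subseteq> a t \<and> a t \<subseteq> U'" "U \<inter> U' \<subseteq> b t \<and> b t \<subseteq> U" if "t \<in> {0..1}" for t
  proof -
    have "(0::real) \<in> {0..1}" "(1::real) \<in> {0..1}" "0 \<le> t" "t \<le> 1" using that by auto
    then show "U \<inter> U' \<subseteq> a t \<and> a t \<subseteq> U'" "U \<inter> U' \<subseteq> b t \<and> b t \<subseteq> U"
      using a b that unfolding open_chain_def by blast+
  qed
  have op: "openin X (a t)" "openin X (b t)" if "t \<in> {0..1}" for t
    using a b that unfolding open_chain_def by auto
  define W where "W t = a t \<union> b (1 - t)" for t
  have IW: "?I \<phi> (W t) = ?I \<phi> (a t) + ?I \<phi> (b (1 - t)) - ?I \<phi> (U \<inter> U')" if "t \<in> {0..1}" "integrable M \<phi>" for t \<phi>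
  proof -
    have t': "1 - t \<in> {0..1}" using that by auto
    have "a t \<inter> b (1 - t) = U \<inter> U'" using bet(1)[OF that(1)] bet(2)[OF t'] by blast
    then show ?thesis unfolding W_def
      using integral_fun_Un_Int[OF that(2), of "a t" "b (1 - t)"] op that t' openin_sets by auto
  qed
  have ends: "a 0 = U \<inter> U'" "a 1 = U'" "b 0 = U \<inter> U'" "b 1 = U" using a b unfolding open_chain_def by auto
  \<comment> \<open>The integral of \<open>g\<close> need not be affine along the chains, but its
    continuity suffices for the intermediate value theorem.\<close>
  have cont: "continuous_on {0..1} (\<lambda>t. ?I g (a t) + ?I g (b (1 - t)) - ?I g (U \<inter> U'))"
    by (intro continuous_intros open_chain_continuous[OF a one g]
        continuous_on_compose2[OF open_chain_continuous[OF b one g], of _ "\<lambda>t. 1 - t"]) auto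
  obtain t where t: "0 \<le> t" "t \<le> 1" "?I g (a t) + ?I g (b (1 - t)) - ?I g (U \<inter> U') = c"
    using IVT'[of "\<lambda>t. ?I g (a t) + ?I g (b (1 - t)) - ?I g (U \<inter> U')" 0 c 1, OF _ _ _ cont] c ends by auto
  show thesis
  proof (rule that[of "W t"])
    show "openin X (W t)" unfolding W_def using op[of t] op[of "1 - t"] t by auto
    show "U \<inter> U' \<subseteq> W t" "W t \<subseteq> U \<union> U'" unfolding W_def using bet[of t] bet[of "1 - t"] t by auto
    show "?I g (W t) = c" using IW[of t g] t g by auto
    fix \<phi> assume \<phi>: "\<phi> \<in> \<Phi>"
    have "?I \<phi> (a t) = ?I \<phi> (U \<inter> U') + t * (?I \<phi> U' - ?I \<phi> (U \<inter> U'))"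
      using a \<phi> t unfolding open_chain_def by auto
    moreover have "?I \<phi> (b (1 - t)) = ?I \<phi> (U \<inter> U') + (1 - t) * (?I \<phi> U - ?I \<phi> (U \<inter> U'))"
      using b \<phi> t unfolding open_chain_def by auto
    ultimately show "?I \<phi> (W t) = ?I \<phi> U"
      using IW[of t \<phi>] t \<Phi>[rule_format, OF \<phi>] eq[OF \<phi>] by (simp add: algebra_simps)
  qed
qed

section \<open>Adding one function to the halving property\<close>

lemma integral_fun_flip:
  assumes "integrable M \<phi>" "A \<in> sets M" "B \<in> sets M" "H \<in> sets M" "A \<subseteq> H" "H \<subseteq> B"
  shows "integral_fun M \<phi> (A \<union> (B - H)) = integral_fun M \<phi> A + integral_fun M \<phi> B - integral_fun M \<phi> H"
proof -
  have "A \<inter> (B - H) = {}" using assms by auto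
  then show ?thesis using integral_fun_Un[of \<phi> A "B - H"] integral_fun_Diff[of \<phi> B H] assms by auto
qed

text \<open>The reflection \<open>A \<union> (B - H)\<close> keeps every integral that is already at
  the mean and moves that of \<open>g\<close> to the opposite side. So \<open>H\<close> and its
  reflection are the two witnesses, in one order or the other.\<close>

lemma both_sides_of_mean:
  assumes \<Phi>: "\<forall>\<phi>\<in>\<Phi>. integrable M \<phi>" and g: "integrable M g"
    and AB: "A \<in> sets M" "B \<in> sets M" and H: "H \<in> sets M" "A \<subseteq> H" "H \<subseteq> B"
    and mean: "\<forall>\<phi>\<in>\<Phi>. integral_fun M \<phi> H = (integral_fun M \<phi> A + integral_fun M \<phi> B) / 2"
    and ne: "integral_fun M g H \<noteq> (integral_fun M g A + integral_fun M g B) / 2"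
  shows "\<exists>L\<in>sets M. A \<subseteq> L \<and> L \<subseteq> B \<and>
      (\<forall>\<phi>\<in>\<Phi>. integral_fun M \<phi> L = (integral_fun M \<phi> A + integral_fun M \<phi> B) / 2) \<and>
      integral_fun M g L < (integral_fun M g A + integral_fun M g B) / 2"
    and "\<exists>L\<in>sets M. A \<subseteq> L \<and> L \<subseteq> B \<and>
      (\<forall>\<phi>\<in>\<Phi>. integral_fun M \<phi> L = (integral_fun M \<phi> A + integral_fun M \<phi> B) / 2) \<and>
      (integral_fun M g A + integral_fun M g B) / 2 < integral_fun M g L"
proof -
  let ?F = "A \<union> (B - H)"
  have F: "?F \<in> sets M" "A \<subseteq> ?F" "?F \<subseteq> B" using AB H by auto
  have \<Phi>F: "integral_fun M \<phi> ?F = (integral_fun M \<phi> A + integral_fun M \<phi> B) / 2" if "\<phi> \<in> \<Phi>" for \<phi>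
    using integral_fun_flip[OF _ AB H, of \<phi>] \<Phi> mean that by (simp add: field_simps)
  have gF: "integral_fun M g ?F = integral_fun M g A + integral_fun M g B - integral_fun M g H"
    by (rule integral_fun_flip[OF g AB H])
  let ?m = "(integral_fun M g A + integral_fun M g B) / 2"
  have "(?m < integral_fun M g H \<and> integral_fun M g ?F < ?m) \<or> (integral_fun M g H < ?m \<and> ?m < integral_fun M g ?F)"
    using gF ne by (simp add: field_simps) linarith
  then obtain L L' where LL: "L \<in> {H, ?F}" "integral_fun M g L < ?m" "L' \<in> {H, ?F}" "?m < integral_fun M g L'"
    by blast
  have *: "K \<in> sets M \<and> A \<subseteq> K \<and> K \<subseteq> B \<and> (\<forall>\<phi>\<in>\<Phi>. integral_fun M \<phi> K = (integral_fun M \<phi> A + integral_fun M \<phi> B) / 2)"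
    if "K \<in> {H, ?F}" for K using that H F mean \<Phi>F by blast
  show "\<exists>L\<in>sets M. A \<subseteq> L \<and> L \<subseteq> B \<and>
      (\<forall>\<phi>\<in>\<Phi>. integral_fun M \<phi> L = (integral_fun M \<phi> A + integral_fun M \<phi> B) / 2) \<and> integral_fun M g L < ?m"
    using *[OF LL(1)] LL(2) by (intro bexI[of _ L]) auto
  show "\<exists>L\<in>sets M. A \<subseteq> L \<and> L \<subseteq> B \<and>
      (\<forall>\<phi>\<in>\<Phi>. integral_fun M \<phi> L = (integral_fun M \<phi> A + integral_fun M \<phi> B) / 2) \<and> ?m < integral_fun M g L"
    using *[OF LL(3)] LL(4) by (intro bexI[of _ L']) auto
qed

text \<open>Approximation turns measurable sets on both sides of the mean of \<open>g\<close> into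
  open ones, close enough to stay on their sides. \<open>open_path\<close> then joins these and
  meets the mean exactly.\<close>

lemma open_halving_insert:
  assumes h: "open_halving \<Phi>" and ap: "open_approx \<Phi>"
    and \<Phi>: "\<forall>\<phi>\<in>\<Phi>. integrable M \<phi>" and one: "(\<lambda>_. 1) \<in> \<Phi>" and g: "integrable M g"
  shows "open_halving (insert g \<Phi>)"
  unfolding open_halving_def
proof (intro allI impI)
  let ?I = "integral_fun M"
  fix A B assume A: "openin X A" and B: "openin X B" and sub: "A \<subseteq> B"
  have s: "A \<in> sets M" "B \<in> sets M" using A B openin_sets by auto
  let ?m = "\<lambda>\<phi>. (?I \<phi> A + ?I \<phi> B) / 2"
  show "\<exists>C. openin X C \<and> A \<subseteq> C \<and> C \<subseteq> B \<and> (\<forall>\<phi>\<in>insert g \<Phi>. ?I \<phi> C = ?m \<phi>)"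
  proof (cases "\<exists>H\<in>sets M. A \<subseteq> H \<and> H \<subseteq> B \<and> (\<forall>\<phi>\<in>\<Phi>. ?I \<phi> H = ?m \<phi>) \<and> ?I g H \<noteq> ?m g")
    case True
    then obtain H where H: "H \<in> sets M" "A \<subseteq> H" "H \<subseteq> B" "\<forall>\<phi>\<in>\<Phi>. ?I \<phi> H = ?m \<phi>" "?I g H \<noteq> ?m g"
      by blast
    obtain L where L: "L \<in> sets M" "A \<subseteq> L" "L \<subseteq> B" "\<And>\<phi>. \<phi> \<in> \<Phi> \<Longrightarrow> ?I \<phi> L = ?m \<phi>" "?I g L < ?m g"
      using both_sides_of_mean(1)[OF \<Phi> g s H] by blast
    obtain L' where L': "L' \<in> sets M" "A \<subseteq> L'" "L' \<subseteq> B" "\<And>\<phi>. \<phi> \<in> \<Phi> \<Longrightarrow> ?I \<phi> L' = ?m \<phi>" "?m g < ?I g L'"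
      using both_sides_of_mean(2)[OF \<Phi> g s H] by blast
    have near: "\<exists>U. openin X U \<and> A \<subseteq> U \<and> U \<subseteq> B \<and> (\<forall>\<phi>\<in>\<Phi>. ?I \<phi> U = ?m \<phi>) \<and> \<bar>?I g U - ?I g K\<bar> < \<eta>"
      if K: "K \<in> sets M" "A \<subseteq> K" "K \<subseteq> B" "\<And>\<phi>. \<phi> \<in> \<Phi> \<Longrightarrow> ?I \<phi> K = ?m \<phi>" and "\<eta> > 0" for K \<eta>
    proof -
      obtain \<delta> where \<delta>: "\<delta> > 0" "\<And>A B. A \<in> sets M \<Longrightarrow> B \<in> sets M \<Longrightarrow> measure M (sym_diff A B) < \<delta>
          \<Longrightarrow> \<bar>?I g A - ?I g B\<bar> < \<eta>"
        using integral_fun_sym_diff_continuous[OF g \<open>\<eta> > 0\<close>] by blast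
      obtain U where "openin X U" "A \<subseteq> U" "U \<subseteq> B" "\<And>\<phi>. \<phi> \<in> \<Phi> \<Longrightarrow> ?I \<phi> U = ?I \<phi> K" "measure M (sym_diff U K) < \<delta>"
        using ap A B K \<delta>(1) unfolding open_approx_def by metis
      then show ?thesis using \<delta>(2)[of U K] K openin_sets by (intro exI[of _ U]) auto
    qed
    \<comment> \<open>The tolerance is the distance of the integral over \<open>L\<close> from the
      mean, so the open set cannot reach the mean.\<close>
    obtain U where U: "openin X U" "A \<subseteq> U" "U \<subseteq> B" "\<And>\<phi>. \<phi> \<in> \<Phi> \<Longrightarrow> ?I \<phi> U = ?m \<phi>" "?I g U < ?m g"
      using near[OF L(1-4), of "?m g - ?I g L"] L(5) by fastforce
    obtain U' where U': "openin X U'" "A \<subseteq> U'" "U' \<subseteq> B" "\<And>\<phi>. \<phi> \<in> \<Phi> \<Longrightarrow> ?I \<phi> U' = ?m \<phi>" "?m g < ?I g U'"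
      using near[OF L'(1-4), of "?I g L' - ?m g"] L'(5) by fastforce
    obtain W where W: "openin X W" "U \<inter> U' \<subseteq> W" "W \<subseteq> U \<union> U'"
      "\<And>\<phi>. \<phi> \<in> \<Phi> \<Longrightarrow> ?I \<phi> W = ?I \<phi> U" "?I g W = ?m g"
      using open_path[OF h \<Phi> one g U(1) U'(1), of "?m g"] U U' by auto
    have "A \<subseteq> W" "W \<subseteq> B" using W(2,3) U(2,3) U'(2,3) by blast+
    moreover have "\<forall>\<phi>\<in>insert g \<Phi>. ?I \<phi> W = ?m \<phi>" using W(4,5) U(4) by auto
    ultimately show ?thesis using W(1) by blast
  next
    case False
    \<comment> \<open>Here the mean of \<open>g\<close> is forced on every measurable set between
      \<open>A\<close> and \<open>B\<close> with the right integrals for \<open>\<Phi>\<close>, so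
      the given halving already works.\<close>
    obtain C where C: "openin X C" "A \<subseteq> C" "C \<subseteq> B" "\<forall>\<phi>\<in>\<Phi>. ?I \<phi> C = ?m \<phi>"
      using h[unfolded open_halving_def, rule_format, OF A B sub] by blast
    have "C \<in> sets M" using C(1) by (rule openin_sets)
    then have "?I g C = ?m g" using False C(2-4) by blast
    then have "\<forall>\<phi>\<in>insert g \<Phi>. ?I \<phi> C = ?m \<phi>" using C(4) by simp
    then show ?thesis using C(1-3) by blast
  qed
qed

section \<open>The constant function, and approximation for it together with
  \<open>f\<close>\<close>

lemma open_halving_one: "open_halving {\<lambda>_. 1}"
  unfolding open_halving_def
proof (intro allI impI)
  fix A B assume A: "openin X A" and B: "openin X B" "A \<subseteq> B"
  have s: "A \<in> sets M" "B \<in> sets M" using A B openin_sets by auto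
  have "measure M A \<le> measure M B" using B s by (intro finite_measure_mono) auto
  then obtain U where U: "openin X U" "A \<subseteq> U" "U \<subseteq> B" "measure M U = (measure M A + measure M B) / 2"
    using open_exact_measure[OF A B, of "(measure M A + measure M B) / 2"] by auto
  then show "\<exists>C. openin X C \<and> A \<subseteq> C \<and> C \<subseteq> B \<and> (\<forall>\<phi>\<in>{\<lambda>_. 1}. integral_fun M \<phi> C = (integral_fun M \<phi> A + integral_fun M \<phi> B) / 2)"
    using s openin_sets by (intro exI[of _ U]) (auto simp: integral_fun_one)
qed

lemma open_approx_one: "open_approx {\<lambda>_. 1}"
  unfolding open_approx_def
proof (intro allI impI)
  fix A B H and \<epsilon> :: real
  assume "openin X A" "openin X B" and H: "H \<in> sets M" "A \<subseteq> H" "H \<subseteq> B" "\<epsilon> > 0"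
  then obtain U where "openin X U" "A \<subseteq> U" "U \<subseteq> B" "measure M U = measure M H" "measure M (sym_diff U H) < \<epsilon>"
    using open_approx_exact_measure by metis
  then show "\<exists>U. openin X U \<and> A \<subseteq> U \<and> U \<subseteq> B \<and> (\<forall>\<phi>\<in>{\<lambda>_. 1}. integral_fun M \<phi> U = integral_fun M \<phi> H) \<and>
      measure M (sym_diff U H) < \<epsilon>"
    using H openin_sets by (intro exI[of _ U]) (auto simp: integral_fun_one)
qed

text \<open>Equal measures of \<open>H\<close> and \<open>L\<close> make \<open>H - L\<close> and
  \<open>L - H\<close> equally large, and the gap between the integrals of \<open>f\<close> lives on
  these differences. Swapping a small piece of the former for one of the latter lowers the integral
  while hardly changing \<open>H\<close>.\<close>

lemma exchange_towards:
  assumes f: "integrable M f" and H: "H \<in> sets M" and L: "L \<in> sets M"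
    and m: "measure M H = measure M L" and less: "integral_fun M f L < integral_fun M f H" and "\<epsilon> > 0"
  obtains K where "K \<in> sets M" "H \<inter> L \<subseteq> K" "K \<subseteq> H \<union> L" "measure M K = measure M H"
    "integral_fun M f K < integral_fun M f H" "measure M (sym_diff K H) < \<epsilon>"
proof -
  have "measure M (H - L) = measure M (L - H)"
    using measure_Un_disjoint_diff[OF H L] measure_Un_disjoint_diff[OF L H] m by (simp add: Int_commute)
  moreover have "integral_fun M f (L - H) < integral_fun M f (H - L)"
    using integral_fun_split[OF f H L] integral_fun_split[OF f L H] less by (simp add: Int_commute)
  ultimately obtain P Q where P: "P \<in> sets M" "P \<subseteq> H - L" and Q: "Q \<in> sets M" "Q \<subseteq> L - H"
    and mPQ: "measure M P = measure M Q" "measure M P < \<epsilon> / 2" and less': "integral_fun M f Q < integral_fun M f P"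
    using exchange_small_pieces[OF nonatomic f, of "H - L" "L - H" "\<epsilon> / 2"] H L \<open>\<epsilon> > 0\<close> by auto
  let ?K = "(H - P) \<union> Q"
  have IK: "integral_fun M \<phi> ?K = integral_fun M \<phi> H - integral_fun M \<phi> P + integral_fun M \<phi> Q"
    if "integrable M \<phi>" for \<phi>
  proof -
    have "(H - P) \<inter> Q = {}" "P \<subseteq> H" using P Q by auto
    then show ?thesis
      using integral_fun_Un[OF that, of "H - P" Q] integral_fun_Diff[OF that H P(1)] H P Q by auto
  qed
  show thesis
  proof (rule that[of ?K])
    show "?K \<in> sets M" "H \<inter> L \<subseteq> ?K" "?K \<subseteq> H \<union> L" using H P Q by auto
    show "measure M ?K = measure M H"
      using IK[of "\<lambda>_. 1"] integral_fun_one[of ?K] integral_fun_one[OF H] integral_fun_one[OF P(1)]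
        integral_fun_one[OF Q(1)] mPQ H P Q by simp
    show "integral_fun M f ?K < integral_fun M f H" using IK[OF f] less' by simp
    have "measure M (sym_diff ?K H) \<le> measure M (P \<union> Q)"
      using P Q H by (intro finite_measure_mono) auto
    also have "\<dots> \<le> measure M P + measure M Q" using P Q by (intro measure_Un_le) auto
    finally show "measure M (sym_diff ?K H) < \<epsilon>" using mPQ by simp
  qed
qed

text \<open>An exchange first brings the integral strictly below that of \<open>H\<close>; an open
  approximation of exact measure then stays within the margin gained. Each of the two changes costs
  at most half of \<open>\<epsilon>\<close>.\<close>

lemma open_below:
  assumes f: "integrable M f" and A: "openin X A" and B: "openin X B"
    and H: "H \<in> sets M" "A \<subseteq> H" "H \<subseteq> B" and L: "L \<in> sets M" "A \<subseteq> L" "L \<subseteq> B"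
    and m: "measure M H = measure M L" and less: "integral_fun M f L < integral_fun M f H" and "\<epsilon> > 0"
  obtains U where "openin X U" "A \<subseteq> U" "U \<subseteq> B" "measure M U = measure M H"
    "integral_fun M f U < integral_fun M f H" "measure M (sym_diff U H) < \<epsilon>"
proof -
  obtain K where K: "K \<in> sets M" "H \<inter> L \<subseteq> K" "K \<subseteq> H \<union> L" "measure M K = measure M H"
    "integral_fun M f K < integral_fun M f H" "measure M (sym_diff K H) < \<epsilon> / 2"
    using exchange_towards[OF f H(1) L(1) m less, of "\<epsilon> / 2"] \<open>\<epsilon> > 0\<close> by auto
  obtain \<delta> where \<delta>: "\<delta> > 0" "\<And>A B. A \<in> sets M \<Longrightarrow> B \<in> sets M \<Longrightarrow> measure M (sym_diff A B) < \<delta>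
      \<Longrightarrow> \<bar>integral_fun M f A - integral_fun M f B\<bar> < integral_fun M f H - integral_fun M f K"
    using integral_fun_sym_diff_continuous[OF f, of "integral_fun M f H - integral_fun M f K"] K(5) by auto
  have "A \<subseteq> K" "K \<subseteq> B" "0 < min \<delta> (\<epsilon> / 2)" using K H L \<delta>(1) \<open>\<epsilon> > 0\<close> by auto
  then obtain U where U: "openin X U" "A \<subseteq> U" "U \<subseteq> B" "measure M U = measure M K"
    "measure M (sym_diff U K) < min \<delta> (\<epsilon> / 2)"
    using open_approx_exact_measure[OF A B K(1)] by blast
  have u: "U \<in> sets M" using U openin_sets by auto
  have "\<bar>integral_fun M f U - integral_fun M f K\<bar> < integral_fun M f H - integral_fun M f K"
    using \<delta>(2)[OF u K(1)] U by auto
  moreover have "measure M (sym_diff U H) \<le> measure M (sym_diff U K \<union> sym_diff K H)"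
    using u K H by (intro finite_measure_mono) auto
  moreover have "measure M (sym_diff U K \<union> sym_diff K H) \<le> measure M (sym_diff U K) + measure M (sym_diff K H)"
    using u K H by (intro measure_Un_le) auto
  ultimately show thesis using that[of U] U K by auto
qed

text \<open>Exact measure alone may leave the integral of \<open>f\<close> slightly wrong. Open sets
  near \<open>H\<close> with too small and too large an integral are therefore joined by
  \<open>open_path\<close> for the constant function, which corrects \<open>f\<close> without
  changing the measure.\<close>

lemma open_approx_one_fun:
  assumes f: "integrable M f"
  shows "open_approx {f, \<lambda>_. 1}"
  unfolding open_approx_def
proof (intro allI impI)
  let ?I = "integral_fun M"
  fix A B H and \<epsilon> :: real
  let ?m = "\<lambda>\<phi>. (?I \<phi> A + ?I \<phi> B) / 2"
  assume A: "openin X A" and B: "openin X B" and H: "H \<in> sets M" "A \<subseteq> H" "H \<subseteq> B"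
    and mean: "\<forall>\<phi>\<in>{f, \<lambda>_. 1}. ?I \<phi> H = ?m \<phi>" and "\<epsilon> > 0"
  have s: "A \<in> sets M" "B \<in> sets M" using A B openin_sets by auto
  have mH: "measure M H = (measure M A + measure M B) / 2"
    using mean H s by (simp add: integral_fun_one)
  show "\<exists>U. openin X U \<and> A \<subseteq> U \<and> U \<subseteq> B \<and> (\<forall>\<phi>\<in>{f, \<lambda>_. 1}. ?I \<phi> U = ?I \<phi> H) \<and>
      measure M (sym_diff U H) < \<epsilon>"
  proof (cases "\<exists>L\<in>sets M. A \<subseteq> L \<and> L \<subseteq> B \<and> measure M L = measure M H \<and> ?I f L \<noteq> ?m f")
    case True
    then obtain L0 where L0: "L0 \<in> sets M" "A \<subseteq> L0" "L0 \<subseteq> B" "measure M L0 = measure M H" "?I f L0 \<noteq> ?m f" by blast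
    then have mean0: "\<forall>\<phi>\<in>{\<lambda>_. 1}. ?I \<phi> L0 = ?m \<phi>" using s mH by (auto simp: integral_fun_one)
    obtain L where L: "L \<in> sets M" "A \<subseteq> L" "L \<subseteq> B" "?I (\<lambda>_. 1) L = ?m (\<lambda>_. 1)" "?I f L < ?m f"
      using both_sides_of_mean(1)[of "{\<lambda>_. 1}", OF _ f s L0(1-3) mean0 L0(5)] by auto
    obtain L' where L': "L' \<in> sets M" "A \<subseteq> L'" "L' \<subseteq> B" "?I (\<lambda>_. 1) L' = ?m (\<lambda>_. 1)" "?m f < ?I f L'"
      using both_sides_of_mean(2)[of "{\<lambda>_. 1}", OF _ f s L0(1-3) mean0 L0(5)] by auto
    have mL: "measure M H = measure M L" "measure M H = measure M L'"
      using L L' mH s by (auto simp: integral_fun_one)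
    have fH: "?I f H = ?m f" using mean by simp
    obtain U where U: "openin X U" "A \<subseteq> U" "U \<subseteq> B" "measure M U = measure M H"
      "?I f U < ?I f H" "measure M (sym_diff U H) < \<epsilon> / 2"
      using open_below[OF f A B H L(1-3) mL(1), of "\<epsilon> / 2"] L fH \<open>\<epsilon> > 0\<close> by auto
    \<comment> \<open>Applying \<open>open_below\<close> to \<open>- f\<close> gives the set with
      the larger integral.\<close>
    obtain U' where U': "openin X U'" "A \<subseteq> U'" "U' \<subseteq> B" "measure M U' = measure M H"
      "?I f H < ?I f U'" "measure M (sym_diff U' H) < \<epsilon> / 2"
      using open_below[OF integrable_minus[OF f] A B H L'(1-3) mL(2), of "\<epsilon> / 2"] L' fH \<open>\<epsilon> > 0\<close>
      by (auto simp: integral_fun_uminus)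
    have u: "U \<in> sets M" "U' \<in> sets M" using U U' openin_sets by auto
    obtain W where W: "openin X W" "U \<inter> U' \<subseteq> W" "W \<subseteq> U \<union> U'"
      "?I (\<lambda>_. 1) W = ?I (\<lambda>_. 1) U" "?I f W = ?I f H"
      using open_path[OF open_halving_one _ _ f U(1) U'(1), of "?I f H"] U U' u by (auto simp: integral_fun_one)
    have w: "W \<in> sets M" using W openin_sets by auto
    \<comment> \<open>As \<open>W\<close> lies between \<open>U \<inter> U'\<close> and
      \<open>U \<union> U'\<close>, it can differ from \<open>H\<close> only where \<open>U\<close>
      or \<open>U'\<close> does.\<close>
    have "measure M (sym_diff W H) \<le> measure M (sym_diff U H \<union> sym_diff U' H)"
      using u w H W by (intro finite_measure_mono) auto
    also have "\<dots> \<le> measure M (sym_diff U H) + measure M (sym_diff U' H)"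
      using u H by (intro measure_Un_le) auto
    finally have "measure M (sym_diff W H) < \<epsilon>" using U U' by simp
    moreover have "A \<subseteq> W" "W \<subseteq> B" using W(2,3) U(2,3) U'(2,3) by blast+
    moreover have "\<forall>\<phi>\<in>{f, \<lambda>_. 1}. ?I \<phi> W = ?I \<phi> H"
      using W(4,5) U(4) u H by (simp add: integral_fun_one)
    ultimately show ?thesis using W(1) by blast
  next
    case False
    \<comment> \<open>Every set of this measure between \<open>A\<close> and \<open>B\<close> has
      the mean integral of \<open>f\<close>, so exact measure suffices.\<close>
    obtain U where U: "openin X U" "A \<subseteq> U" "U \<subseteq> B" "measure M U = measure M H" "measure M (sym_diff U H) < \<epsilon>"
      using open_approx_exact_measure[OF A B H \<open>\<epsilon> > 0\<close>] .
    then have "?I f U = ?I f H" using False mean openin_sets by auto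
    then show ?thesis using U H openin_sets by (intro exI[of _ U]) (auto simp: integral_fun_one)
  qed
qed

end

theorem theorem0p5:
  fixes X :: "'a topology" and M :: "'a measure" and f g :: "'a \<Rightarrow> real"
  assumes "topspace X = space M"
    and "\<And>U. openin X U \<Longrightarrow> U \<in> sets M"
    and "finite_measure M"
    and "nonatomic M"
    and "weakly_outer_regular X M"
    and "integrable M f"
    and "integrable M g"
  shows "\<exists>u. O_segment X M (integral_fun M f) u \<and> O_segment X M (integral_fun M g) u"
proof -
  interpret finite_measure M by fact
  interpret nonatomic_regular_measure M X
    by unfold_locales (use assms in auto)
  \<comment> \<open>Adding \<open>f\<close> uses approximation for the constant alone; adding
    \<open>g\<close> then uses approximation for \<open>f\<close> and the constant together.\<close>
  have 1: "open_halving {f, \<lambda>_. 1}"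
    using assms by (intro open_halving_insert open_halving_one open_approx_one) auto
  have 2: "open_halving {g, f, \<lambda>_. 1}"
    using assms by (intro open_halving_insert[OF 1] open_approx_one_fun) auto
  obtain u where u: "open_chain {g, f, \<lambda>_. 1} {} (space M) u"
    using open_halving_imp_chain[OF 2, of "{}" "space M"] assms
    by (metis empty_iff insert_iff integrable_const openin_empty openin_topspace empty_subsetI)
  have "O_segment X M (integral_fun M \<phi>) u" if "\<phi> \<in> {f, g}" for \<phi>
  proof -
    \<comment> \<open>With starting value 0, the affine formula of the chain becomes the
      proportionality required of a segment.\<close>
    have "integral_fun M \<phi> {} = 0" by (simp add: integral_fun_def set_lebesgue_integral_def)
    then show ?thesis
      using u that openin_sets unfolding O_segment_def segment_def open_chain_def by auto
  qed
  then show ?thesis by blast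
qed

end
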